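(* Let $n \geq 2$ and let $p(z)=\sum_{j=0}^{n} a_j z^j$ be a real polynomial with positive coefficients $a_0,\dots,a_n>0$. (a) Let $$\gamma_1=\frac{a_{n-1}}{a_n}\quad\text{and}\quad \gamma_0=\max\left\{0,\ \max_{0\leq j\leq n-2}\frac{a_j-\gamma_1 a_{j+1}}{a_{j+2}}\right\}.$$ Then all the zeros of $p$ lie in the closed disk $\left\{z\in\mathbb{C}: |z|\leq \tfrac12\left(\gamma_1+(\gamma_1^2+4\gamma_0)^{1/2}\right)\right\}$. (b) Let $$\delta_1=\frac{a_1}{a_0}\quad\text{and}\quad \delta_0=\max\left\{0,\ \max_{0\leq j\leq n-2}\frac{a_{j+2}-\delta_1 a_{j+1}}{a_j}\right\}.$$ Then no zero of $p$ lies in the open disk $$\left\{z\in\mathbb{C}: |z|<\frac{2}{\delta_1+(\delta_1^2+4\delta_0)^{1/2}}\right\}.$$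
   Context: Zeros are complex zeros. *)

theory Defs
  imports Complex_Main "HOL-Computational_Algebra.Polynomial"
begin

end

theory Submission
  imports Defs
begin

text \<open>
  Part (b) is the basic statement. Multiply \<open>f z = \<Sum>j\<le>n. a j * z ^ j\<close> by the quadratic
  \<open>1 - d\<^sub>1 * z - d\<^sub>0 * z\<^sup>2\<close>. The constants are chosen so that the product has constant
  term \<open>a 0 > 0\<close>, no linear term, and only nonpositive coefficients from degree 2 on. At a
  zero \<open>z\<close> of \<open>f\<close> the higher terms must cancel \<open>a 0\<close>. By the triangle inequality they
  weigh at least \<open>a 0\<close> in absolute value at \<open>r = cmod z\<close>, where they all have the
  same sign, so the product is nonpositive at \<open>r\<close>. Since \<open>f r > 0\<close>, it is the
  quadratic that is nonpositive at \<open>r\<close>, and hence \<open>r\<close> is at least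
  its positive root \<open>2 / (d\<^sub>1 + sqrt (d\<^sub>1\<^sup>2 + 4 * d\<^sub>0))\<close>. The lemmas
  \<open>quadratic_multiplier_identity\<close> and \<open>zero_imp_quadratic_ge_one\<close> carry this argument.

  Part (a) is part (b) for the reversed coefficients \<open>a (n - j)\<close>: their polynomial has the zeros
  \<open>1 / z\<close>, and reversal turns \<open>\<gamma>\<^sub>1, \<gamma>\<^sub>0\<close> into \<open>\<delta>\<^sub>1, \<delta>\<^sub>0\<close>.
\<close>

text \<open>
  Extending the coefficients by zero makes the product of the polynomial and the quadratic a single
  sum: \<open>a\<close>, and its shifts by one and by two, may all be summed up to \<open>n\<close>.
\<close>

lemma quadratic_multiplier_identity:
  fixes a :: "nat \<Rightarrow> 'a :: comm_ring_1"
  assumes supp: "\<And>j. j > n \<Longrightarrow> a j = 0"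
    and a1: "a 1 = d\<^sub>1 * a 0"
  shows "(1 - d\<^sub>1 * x - d\<^sub>0 * x\<^sup>2) * (\<Sum>j\<le>n. a j * x ^ j)
           = a 0 - x\<^sup>2 * (\<Sum>j\<le>n. (d\<^sub>1 * a (j + 1) + d\<^sub>0 * a j - a (j + 2)) * x ^ j)"
proof -
  let ?f = "\<Sum>j\<le>n. a j * x ^ j"
  let ?f1 = "\<Sum>j\<le>n. a (j + 1) * x ^ j" and ?f2 = "\<Sum>j\<le>n. a (j + 2) * x ^ j"
  have shift: "(\<Sum>j\<le>n. b j * x ^ j) = b 0 + x * (\<Sum>j\<le>n. b (j + 1) * x ^ j)"
    if "b (Suc n) = 0" for b :: "nat \<Rightarrow> 'a"
  proof -
    have "(\<Sum>j\<le>n. b j * x ^ j) = (\<Sum>j\<le>Suc n. b j * x ^ j)"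
      using that by simp
    also have "\<dots> = b 0 + (\<Sum>j\<le>n. b (Suc j) * x ^ Suc j)"
      by (subst sum.atMost_Suc_shift) simp
    finally show ?thesis
      by (simp add: sum_distrib_left algebra_simps)
  qed
  have f: "?f = a 0 + x * ?f1"
    using shift[of a] supp by simp
  have f1: "?f1 = a 1 + x * ?f2"
    using shift[of "\<lambda>j. a (j + 1)"] supp by simp
  have "(\<Sum>j\<le>n. (d\<^sub>1 * a (j + 1) + d\<^sub>0 * a j - a (j + 2)) * x ^ j)
          = d\<^sub>1 * ?f1 + d\<^sub>0 * ?f - ?f2"
    by (simp add: sum.distrib sum_subtractf sum_distrib_left algebra_simps)
  then have "a 0 - x\<^sup>2 * (\<Sum>j\<le>n. (d\<^sub>1 * a (j + 1) + d\<^sub>0 * a j - a (j + 2)) * x ^ j)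
          = a 0 - x\<^sup>2 * (d\<^sub>1 * ?f1 + d\<^sub>0 * ?f - ?f2)"
    by simp
  also have "\<dots> = a 0 - d\<^sub>1 * x * (x * ?f1) - d\<^sub>0 * x\<^sup>2 * ?f + x * (x * ?f2)"
    by (simp add: algebra_simps power2_eq_square)
  also have "x * (x * ?f2) = ?f - a 0 - x * (d\<^sub>1 * a 0)"
    using f f1 a1 by (simp add: algebra_simps)
  also have "x * ?f1 = ?f - a 0"
    using f by simp
  finally show ?thesis
    by (simp add: algebra_simps)
qed

text \<open>
  The identity is used twice, at \<open>z\<close> where its left-hand side vanishes, and at \<open>cmod z\<close>
  where the sum on its right-hand side has nonnegative terms, the absolute values of those at \<open>z\<close>.
\<close>

lemma zero_imp_quadratic_ge_one:
  fixes a :: "nat \<Rightarrow> real" and z :: complex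
  assumes supp: "\<And>j. j > n \<Longrightarrow> a j = 0"
    and nonneg: "\<And>j. a j \<ge> 0"
    and a0: "a 0 > 0"
    and a1: "a 1 = d\<^sub>1 * a 0"
    and rec: "\<And>j. a (j + 2) \<le> d\<^sub>1 * a (j + 1) + d\<^sub>0 * a j"
    and zero: "(\<Sum>j\<le>n. complex_of_real (a j) * z ^ j) = 0"
  shows "1 \<le> d\<^sub>1 * cmod z + d\<^sub>0 * (cmod z)\<^sup>2"
proof -
  define r where "r = cmod z"
  define c where "c j = d\<^sub>1 * a (j + 1) + d\<^sub>0 * a j - a (j + 2)" for j
  have c: "c j \<ge> 0" for j
    using rec[of j] by (simp add: c_def)
  have "complex_of_real (a 0) = z\<^sup>2 * (\<Sum>j\<le>n. complex_of_real (c j) * z ^ j)"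
    using quadratic_multiplier_identity[of n "\<lambda>j. complex_of_real (a j)" "complex_of_real d\<^sub>1" z
        "complex_of_real d\<^sub>0"] supp a1 zero
    by (simp add: c_def)
  then have "cmod (complex_of_real (a 0)) = r\<^sup>2 * cmod (\<Sum>j\<le>n. complex_of_real (c j) * z ^ j)"
    by (simp add: norm_mult norm_power r_def)
  then have "a 0 = r\<^sup>2 * cmod (\<Sum>j\<le>n. complex_of_real (c j) * z ^ j)"
    using a0 by simp
  also have "cmod (\<Sum>j\<le>n. complex_of_real (c j) * z ^ j) \<le> (\<Sum>j\<le>n. c j * r ^ j)"
    by (rule order_trans[OF norm_sum]) (simp add: norm_mult norm_power r_def c)
  finally have "a 0 \<le> r\<^sup>2 * (\<Sum>j\<le>n. c j * r ^ j)"
    by (simp add: mult_left_mono)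
  then have "(1 - d\<^sub>1 * r - d\<^sub>0 * r\<^sup>2) * (\<Sum>j\<le>n. a j * r ^ j) \<le> 0"
    using quadratic_multiplier_identity[of n a d\<^sub>1 r d\<^sub>0] supp a1 by (simp add: c_def)
  moreover have "(\<Sum>j\<le>n. a j * r ^ j) > 0"
    by (rule sum_pos2[of _ 0]) (use a0 nonneg in \<open>auto simp: r_def\<close>)
  ultimately have "1 - d\<^sub>1 * r - d\<^sub>0 * r\<^sup>2 \<le> 0"
    by (simp add: mult_le_0_iff)
  then show ?thesis
    by (simp add: r_def)
qed

text \<open>
  The bound is the positive root of \<open>1 - d\<^sub>1 * x - d\<^sub>0 * x\<^sup>2\<close>, in the rationalized form that
  also covers the linear case \<open>d\<^sub>0 = 0\<close>.
\<close>

lemma positive_root_le: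
  fixes d\<^sub>1 d\<^sub>0 r :: real
  assumes "d\<^sub>1 > 0" "d\<^sub>0 \<ge> 0" "r \<ge> 0" and ge: "1 \<le> d\<^sub>1 * r + d\<^sub>0 * r\<^sup>2"
  shows "2 / (d\<^sub>1 + sqrt (d\<^sub>1\<^sup>2 + 4 * d\<^sub>0)) \<le> r"
proof (rule ccontr)
  define s where "s = sqrt (d\<^sub>1\<^sup>2 + 4 * d\<^sub>0)"
  have s2: "s\<^sup>2 = d\<^sub>1\<^sup>2 + 4 * d\<^sub>0"
    using assms by (simp add: s_def)
  have s: "s \<ge> d\<^sub>1"
    unfolding s_def using assms by (intro real_le_rsqrt) simp
  assume "\<not> ?thesis"
  then have "r < 2 / (d\<^sub>1 + s)"
    by (simp only: s_def not_le)
  then have less: "(d\<^sub>1 + s) * r < 2"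
    using s assms by (simp add: pos_less_divide_eq mult.commute)
  have "(s - d\<^sub>1) * r * (2 - (d\<^sub>1 + s) * r) \<ge> 0"
    using s less assms by simp
  \<comment> \<open>The left-hand side is \<open>2 * ((d\<^sub>1 + s) * r) - 4 * (d\<^sub>1 * r + d\<^sub>0 * r\<^sup>2)\<close>,
    because \<open>4 * d\<^sub>0 = (s - d\<^sub>1) * (s + d\<^sub>1)\<close>.\<close>
  moreover have "4 * (d\<^sub>0 * r\<^sup>2) = (s\<^sup>2 - d\<^sub>1\<^sup>2) * r\<^sup>2"
    by (simp add: s2)
  ultimately have "4 * (d\<^sub>1 * r) + 4 * (d\<^sub>0 * r\<^sup>2) \<le> 2 * (d\<^sub>1 * r) + 2 * (s * r)"
    by (simp add: algebra_simps power2_eq_square)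
  moreover have "d\<^sub>1 * r + s * r < 2"
    using less by (simp only: distrib_right)
  ultimately show False
    using ge by linarith
qed

text \<open>
  Dividing by \<open>a j\<close> turns the recursive bound on the coefficients into a condition on \<open>d\<^sub>0\<close>
  whose least nonnegative solution is the maximum below. The maximum with 0
  serves the indices at the top, where \<open>j + 2 > n\<close> and zero stands for \<open>a (j + 2)\<close>: there the bound
  follows from the nonnegativity of \<open>d\<^sub>1\<close> and \<open>d\<^sub>0\<close>.
\<close>

lemma cmod_zero_ge:
  fixes a :: "nat \<Rightarrow> real" and z :: complex
  assumes n: "n \<ge> 2"
    and pos: "\<And>j. j \<le> n \<Longrightarrow> a j > 0"
    and d1: "d\<^sub>1 = a 1 / a 0"
    and d0: "d\<^sub>0 = max 0 (Max ((\<lambda>j. (a (j + 2) - d\<^sub>1 * a (j + 1)) / a j) ` {0..n - 2}))"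
    and zero: "(\<Sum>j\<le>n. complex_of_real (a j) * z ^ j) = 0"
  shows "2 / (d\<^sub>1 + sqrt (d\<^sub>1\<^sup>2 + 4 * d\<^sub>0)) \<le> cmod z"
proof -
  define b where "b j = (if j \<le> n then a j else 0)" for j
  have d1_pos: "d\<^sub>1 > 0"
    using pos[of 0] pos[of 1] n by (simp add: d1)
  have d0_nonneg: "d\<^sub>0 \<ge> 0"
    by (simp add: d0)
  have b_nonneg: "b j \<ge> 0" for j
    using pos[of j] by (auto simp: b_def intro: less_imp_le)
  have rec: "b (j + 2) \<le> d\<^sub>1 * b (j + 1) + d\<^sub>0 * b j" for j
  proof (cases "j + 2 \<le> n")
    case True
    have "(a (j + 2) - d\<^sub>1 * a (j + 1)) / a j
            \<le> Max ((\<lambda>j. (a (j + 2) - d\<^sub>1 * a (j + 1)) / a j) ` {0..n - 2})"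
      using True by (intro Max_ge) auto
    then have "(a (j + 2) - d\<^sub>1 * a (j + 1)) / a j \<le> d\<^sub>0"
      by (simp add: d0)
    then show ?thesis
      using True pos[of j] by (simp add: b_def pos_divide_le_eq)
  next
    case False
    then have "b (j + 2) = 0"
      by (simp add: b_def)
    moreover have "d\<^sub>1 * b (j + 1) \<ge> 0" "d\<^sub>0 * b j \<ge> 0"
      using d1_pos d0_nonneg b_nonneg by simp_all
    ultimately show ?thesis
      by linarith
  qed
  have "(\<Sum>j\<le>n. complex_of_real (b j) * z ^ j) = 0"
    using zero by (simp add: b_def)
  moreover have "b 0 > 0" "b 1 = d\<^sub>1 * b 0" "\<And>j. j > n \<Longrightarrow> b j = 0"
    using pos[of 0] n by (simp_all add: b_def d1)
  ultimately have "1 \<le> d\<^sub>1 * cmod z + d\<^sub>0 * (cmod z)\<^sup>2"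
    using zero_imp_quadratic_ge_one[of n b d\<^sub>1 d\<^sub>0 z] b_nonneg rec by blast
  then show ?thesis
    using positive_root_le[of d\<^sub>1 d\<^sub>0 "cmod z"] d1_pos d0_nonneg by simp
qed

lemma sum_reversed_coeffs_inverse:
  fixes a :: "nat \<Rightarrow> 'a :: field"
  assumes "x \<noteq> 0"
  shows "x ^ n * (\<Sum>j\<le>n. a (n - j) * inverse x ^ j) = (\<Sum>j\<le>n. a j * x ^ j)"
proof -
  have "x ^ n * (\<Sum>j\<le>n. a (n - j) * inverse x ^ j) = (\<Sum>j\<le>n. a (n - j) * x ^ (n - j))"
    unfolding sum_distrib_left
    by (rule sum.cong) (use assms in \<open>auto simp: power_diff power_inverse field_simps\<close>)
  also have "\<dots> = (\<Sum>j\<le>n. a j * x ^ j)"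
    using sum.nat_diff_reindex[of "\<lambda>j. a j * x ^ j" "Suc n"] by (simp add: lessThan_Suc_atMost)
  finally show ?thesis .
qed

lemma poly_of_real_sum_monom:
  "poly (map_poly complex_of_real (\<Sum>j\<le>n. monom (a j) j)) z
     = (\<Sum>j\<le>n. complex_of_real (a j) * z ^ j)"
proof -
  have "map_poly complex_of_real (\<Sum>j\<le>n. monom (a j) j)
          = (\<Sum>j\<le>n. monom (complex_of_real (a j)) j)"
    by (rule poly_eqI) (simp add: coeff_map_poly coeff_sum)
  then show ?thesis
    by (simp add: poly_sum poly_monom)
qed

theorem theorem3p2:
  fixes n :: nat and a :: "nat \<Rightarrow> real" and p :: "real poly"
    and \<gamma>\<^sub>0 \<gamma>\<^sub>1 \<delta>\<^sub>0 \<delta>\<^sub>1 :: real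
  assumes "n \<ge> 2"
    and "\<And>j. j \<le> n \<Longrightarrow> a j > 0"
    and "p = (\<Sum>j\<le>n. monom (a j) j)"
    and "\<gamma>\<^sub>1 = a (n - 1) / a n"
    and "\<gamma>\<^sub>0 = max 0 (Max ((\<lambda>j. (a j - \<gamma>\<^sub>1 * a (j + 1)) / a (j + 2)) ` {0..n - 2}))"
    and "\<delta>\<^sub>1 = a 1 / a 0"
    and "\<delta>\<^sub>0 = max 0 (Max ((\<lambda>j. (a (j + 2) - \<delta>\<^sub>1 * a (j + 1)) / a j) ` {0..n - 2}))"
  shows "{z :: complex. poly (map_poly complex_of_real p) z = 0}
           \<subseteq> {z. cmod z \<le> 1 / 2 * (\<gamma>\<^sub>1 + sqrt (\<gamma>\<^sub>1 ^ 2 + 4 * \<gamma>\<^sub>0))} \<and>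
         {z :: complex. poly (map_poly complex_of_real p) z = 0}
           \<inter> {z. cmod z < 2 / (\<delta>\<^sub>1 + sqrt (\<delta>\<^sub>1 ^ 2 + 4 * \<delta>\<^sub>0))} = {}"
proof -
  have eval: "poly (map_poly complex_of_real p) z = (\<Sum>j\<le>n. complex_of_real (a j) * z ^ j)" for z
    by (simp only: assms(3) poly_of_real_sum_monom)
  have lower: "2 / (\<delta>\<^sub>1 + sqrt (\<delta>\<^sub>1 ^ 2 + 4 * \<delta>\<^sub>0)) \<le> cmod z"
    if "poly (map_poly complex_of_real p) z = 0" for z
    using cmod_zero_ge[OF assms(1,2,6,7)] that by (simp only: eval)
  have upper: "cmod z \<le> 1 / 2 * (\<gamma>\<^sub>1 + sqrt (\<gamma>\<^sub>1 ^ 2 + 4 * \<gamma>\<^sub>0))"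
    if zero: "poly (map_poly complex_of_real p) z = 0" for z
  proof -
    have "z \<noteq> 0"
    proof
      assume "z = 0"
      then have "(\<Sum>j\<le>n. complex_of_real (a j) * z ^ j) = complex_of_real (a 0)"
        by (simp add: power_0_left if_distrib sum.delta cong: if_cong)
      then show False
        using zero assms(2)[of 0] by (simp add: eval)
    qed
    then have rev_zero: "(\<Sum>j\<le>n. complex_of_real (a (n - j)) * inverse z ^ j) = 0"
      using sum_reversed_coeffs_inverse[of z n "\<lambda>j. complex_of_real (a j)"] zero
      by (simp add: eval)
    define q where "q j = (a j - \<gamma>\<^sub>1 * a (j + 1)) / a (j + 2)" for j
    \<comment> \<open>Reversing the coefficients reverses the list of quotients, so the maximum is the same.\<close>
    have "{0..n - 2} = (\<lambda>j. n - 2 - j) ` {0..n - 2}"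
    proof (intro set_eqI iffI)
      fix j assume "j \<in> {0..n - 2}"
      then show "j \<in> (\<lambda>j. n - 2 - j) ` {0..n - 2}"
        by (intro image_eqI[of _ _ "n - 2 - j"]) auto
    qed auto
    then have "q ` {0..n - 2} = (\<lambda>j. q (n - 2 - j)) ` {0..n - 2}"
      by (metis image_image)
    also have "\<dots> = (\<lambda>j. (a (n - (j + 2)) - \<gamma>\<^sub>1 * a (n - (j + 1))) / a (n - j)) ` {0..n - 2}"
    proof (rule image_cong)
      fix j assume "j \<in> {0..n - 2}"
      then have "n - 2 - j = n - (j + 2)" "n - 2 - j + 1 = n - (j + 1)" "n - 2 - j + 2 = n - j"
        using assms(1) by auto
      then show "q (n - 2 - j) = (a (n - (j + 2)) - \<gamma>\<^sub>1 * a (n - (j + 1))) / a (n - j)"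
        by (simp only: q_def)
    qed simp
    finally have q_image: "q ` {0..n - 2}
        = (\<lambda>j. (a (n - (j + 2)) - \<gamma>\<^sub>1 * a (n - (j + 1))) / a (n - j)) ` {0..n - 2}" .
    have "\<gamma>\<^sub>0 = max 0 (Max (q ` {0..n - 2}))"
      unfolding q_def by (rule assms(5))
    then have "\<gamma>\<^sub>0 = max 0 (Max ((\<lambda>j. (a (n - (j + 2)) - \<gamma>\<^sub>1 * a (n - (j + 1))) / a (n - j)) ` {0..n - 2}))"
      by (simp only: q_image)
    then have "2 / (\<gamma>\<^sub>1 + sqrt (\<gamma>\<^sub>1\<^sup>2 + 4 * \<gamma>\<^sub>0)) \<le> inverse (cmod z)"
      using cmod_zero_ge[of n "\<lambda>j. a (n - j)" \<gamma>\<^sub>1 \<gamma>\<^sub>0 "inverse z"] assms(1,2,4) rev_zero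
      by (simp add: norm_inverse)
    moreover have "\<gamma>\<^sub>1 > 0" "\<gamma>\<^sub>0 \<ge> 0"
      using assms(2)[of n] assms(2)[of "n - 1"] assms(4,5) by simp_all
    moreover from this have "\<gamma>\<^sub>1 + sqrt (\<gamma>\<^sub>1\<^sup>2 + 4 * \<gamma>\<^sub>0) > 0"
      by (intro add_pos_nonneg) simp_all
    moreover have "cmod z > 0"
      using \<open>z \<noteq> 0\<close> by simp
    ultimately show ?thesis
      by (simp add: field_simps)
  qed
  show ?thesis
    using lower upper by (auto simp: not_less[symmetric])
qed

end
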